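(* Let $\mathcal H$ be a finite-dimensional Hilbert space, let $\mathcal C\subseteq\mathcal H$ be a nonzero subspace with orthogonal projector $P$, and for each small $\epsilon>0$ let $\mathcal E(\rho)=\sum_{n\in K}A_n\rho A_n^\dagger$ be a trace-preserving quantum operation on $\mathcal H$ with finite index set $K$ (independent of $\epsilon$) and operators $A_n=A_n(\epsilon)$. Let $K_{re}\subseteq K$ and let $t\ge 0$ be an integer. For $n\in K_{re}$ let $A_nP=U_n\sqrt{PA_n^\dagger A_nP}$ be a polar decomposition with $U_n$ unitary on $\mathcal H$, and let $p_n$ and $p_n\lambda_n$ be, respectively, the largest and the smallest eigenvalue of $PA_n^\dagger A_nP$ regarded as an operator on $\mathcal C$. Suppose that $$PU_m^\dagger U_nP=\delta_{mn}P\qquad\text{for all } m,n\in K_{re}.$$ Then there is a trace-preserving quantum operation $\mathcal R$ on $\mathcal H$ such that $$\min_{|\psi\rangle\in\mathcal C,\ \langle\psi|\psi\rangle=1}\langle\psi|\,\mathcal R(\mathcal E(|\psi\rangle\langle\psi|))\,|\psi\rangle\ \ge\ \sum_{n\in K_{re}}p_n\lambda_n .$$ If moreover, as $\epsilon\to0$, $p_n(1-\lambda_n)\le \mathcal O(\epsilon^{t+1})$ for all $n\in K_{re}$, and $\sum_{n\in K_{re}}\langle\psi|A_n^\dagger A_n|\psi\rangle\ge 1-\mathcal O(\epsilon^{t+1})$ for all unit vectors $|\psi\rangle\in\mathcal C$, then this minimum is at least $1-\mathcal O(\epsilon^{t+1})$.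
   Context: A quantum operation is a completely positive, trace non-increasing linear map on operators; here it is given by an operator sum representation, and trace-preserving means $\sum_n A_n^\dagger A_n=I$. If $p_n=0$ the number $\lambda_n$ is taken to be $1$. The quantities $A_n,U_n,p_n,\lambda_n$ may depend on the small parameter $\epsilon$. *)

theory Defs
  imports "HOL-Analysis.Analysis" "HOL-Library.Landau_Symbols"
begin

text \<open>A finite-dimensional complex Hilbert space is modelled as \<open>complex ^ 'n\<close> with the inner
  product below; operators on it are the matrices \<open>complex ^ 'n ^ 'n\<close>.\<close>

text \<open>Conjugate-linear in the first argument, as in the bra-ket convention.\<close>
definition cinner :: "complex ^ 'n \<Rightarrow> complex ^ 'n \<Rightarrow> complex" where
  "cinner u v = (\<Sum>i\<in>UNIV. cnj (u $ i) * v $ i)"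

text \<open>The library constant \<open>adjoint\<close> refers to the real inner product, hence a separate notion.\<close>
definition cadjoint :: "complex ^ 'n ^ 'm \<Rightarrow> complex ^ 'm ^ 'n" where
  "cadjoint M = (\<chi> i j. cnj (M $ j $ i))"

definition ketbra :: "complex ^ 'n \<Rightarrow> complex ^ 'm \<Rightarrow> complex ^ 'm ^ 'n" where
  "ketbra u v = (\<chi> i j. u $ i * cnj (v $ j))"

definition unitary :: "complex ^ 'n ^ 'n \<Rightarrow> bool" where
  "unitary U \<longleftrightarrow> cadjoint U ** U = mat 1 \<and> U ** cadjoint U = mat 1"

definition positive_op :: "complex ^ 'n ^ 'n \<Rightarrow> bool" where
  "positive_op S \<longleftrightarrow> cadjoint S = S \<and> (\<forall>x. 0 \<le> Re (cinner x (S *v x)))"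

text \<open>A positive operator has exactly one positive square root, so \<open>is_pos_sqrt S X\<close> says
  that \<open>S\<close> is the square root of \<open>X\<close>.\<close>
definition is_pos_sqrt :: "complex ^ 'n ^ 'n \<Rightarrow> complex ^ 'n ^ 'n \<Rightarrow> bool" where
  "is_pos_sqrt S X \<longleftrightarrow> positive_op S \<and> S ** S = X"

definition orthogonal_projector :: "(complex ^ 'n) set \<Rightarrow> complex ^ 'n ^ 'n \<Rightarrow> bool" where
  "orthogonal_projector C P \<longleftrightarrow>
     P ** P = P \<and> cadjoint P = P \<and> range (\<lambda>x. P *v x) = C"

text \<open>Only used for Hermitian \<open>X\<close> mapping \<open>C\<close> into itself; all eigenvalues of \<open>X\<close> regarded as
  an operator on \<open>C\<close> are then real.\<close>
definition eigenvalues_on :: "(complex ^ 'n) set \<Rightarrow> complex ^ 'n ^ 'n \<Rightarrow> real set" where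
  "eigenvalues_on C X = {r. \<exists>v\<in>C. v \<noteq> 0 \<and> X *v v = complex_of_real r *s v}"

definition is_largest_eigenvalue_on ::
    "(complex ^ 'n) set \<Rightarrow> complex ^ 'n ^ 'n \<Rightarrow> real \<Rightarrow> bool" where
  "is_largest_eigenvalue_on C X r \<longleftrightarrow>
     r \<in> eigenvalues_on C X \<and> (\<forall>s\<in>eigenvalues_on C X. s \<le> r)"

definition is_smallest_eigenvalue_on ::
    "(complex ^ 'n) set \<Rightarrow> complex ^ 'n ^ 'n \<Rightarrow> real \<Rightarrow> bool" where
  "is_smallest_eigenvalue_on C X r \<longleftrightarrow>
     r \<in> eigenvalues_on C X \<and> (\<forall>s\<in>eigenvalues_on C X. r \<le> s)"

definition operator_sum ::
    "'k set \<Rightarrow> ('k \<Rightarrow> complex ^ 'n ^ 'n) \<Rightarrow> complex ^ 'n ^ 'n \<Rightarrow> complex ^ 'n ^ 'n" where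
  "operator_sum K A \<rho> = (\<Sum>n\<in>K. A n ** \<rho> ** cadjoint (A n))"

definition trace_preserving :: "'k set \<Rightarrow> ('k \<Rightarrow> complex ^ 'n ^ 'n) \<Rightarrow> bool" where
  "trace_preserving K A \<longleftrightarrow> (\<Sum>n\<in>K. cadjoint (A n) ** A n) = mat 1"

definition tp_quantum_operation :: "(complex ^ 'n ^ 'n \<Rightarrow> complex ^ 'n ^ 'n) \<Rightarrow> bool" where
  "tp_quantum_operation R \<longleftrightarrow>
     (\<exists>(L :: nat set) B. finite L \<and> trace_preserving L B \<and> R = operator_sum L B)"

text \<open>For a completely positive map \<open>F\<close> the inner product is real.\<close>
definition fidelity ::
    "(complex ^ 'n ^ 'n \<Rightarrow> complex ^ 'n ^ 'n) \<Rightarrow> complex ^ 'n \<Rightarrow> real" where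
  "fidelity F \<psi> = Re (cinner \<psi> (F (ketbra \<psi> \<psi>) *v \<psi>))"

definition unit_vectors :: "(complex ^ 'n) set \<Rightarrow> (complex ^ 'n) set" where
  "unit_vectors C = {\<psi>\<in>C. cinner \<psi> \<psi> = 1}"

text \<open>The minimum is required to be attained, not just to be an infimum.\<close>
definition is_min_fidelity ::
    "(complex ^ 'n) set \<Rightarrow> (complex ^ 'n ^ 'n \<Rightarrow> complex ^ 'n ^ 'n) \<Rightarrow> real \<Rightarrow> bool" where
  "is_min_fidelity C F m \<longleftrightarrow>
     (\<exists>\<psi>\<in>unit_vectors C. fidelity F \<psi> = m) \<and> (\<forall>\<psi>\<in>unit_vectors C. m \<le> fidelity F \<psi>)"

end

theory Submission
  imports Defs
begin

text \<open>The recovery operation has the Kraus operators \<open>P U\<^sub>k\<^sup>\<dagger>\<close> and \<open>1 - Q\<close> with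
  \<open>Q = \<Sum>\<^sub>k U\<^sub>k P U\<^sub>k\<^sup>\<dagger>\<close>; by the orthogonality condition \<open>Q\<close> is a projector, so the operation is
  trace-preserving. With \<open>S\<^sub>n\<close> the square root of \<open>P A\<^sub>n\<^sup>\<dagger> A\<^sub>n P\<close>, the term for \<open>P U\<^sub>n\<^sup>\<dagger> A\<^sub>n\<close>
  contributes \<open>\<langle>\<psi>|S\<^sub>n|\<psi>\<rangle>\<^sup>2\<close> to the fidelity of \<open>\<psi>\<close>. This is at least \<open>p\<^sub>n \<lambda>\<^sub>n\<close>, because the minimum of the
  Rayleigh quotient of \<open>S\<^sub>n\<close> on \<open>C\<close> is an eigenvalue of \<open>S\<^sub>n\<close>. The asymptotic bound follows from
  \<open>\<Sum>\<^sub>n p\<^sub>n \<lambda>\<^sub>n = \<Sum>\<^sub>n p\<^sub>n - \<Sum>\<^sub>n p\<^sub>n (1 - \<lambda>\<^sub>n)\<close> and \<open>p\<^sub>n \<ge> \<langle>\<psi>|A\<^sub>n\<^sup>\<dagger> A\<^sub>n|\<psi>\<rangle>\<close> for any one unit vector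
  \<open>\<psi>\<close> of \<open>C\<close>.\<close>

section \<open>Algebra of the inner product, the adjoint and finite matrix sums\<close>

lemma cinner_add_left: "cinner (x + y) z = cinner x z + cinner y z"
  by (simp add: cinner_def algebra_simps sum.distrib)

lemma cinner_add_right: "cinner x (y + z) = cinner x y + cinner x z"
  by (simp add: cinner_def algebra_simps sum.distrib)

lemma cinner_scale_left: "cinner (c *s x) y = cnj c * cinner x y"
  by (simp add: cinner_def sum_distrib_left algebra_simps)

lemma cinner_scale_right: "cinner x (c *s y) = c * cinner x y"
  by (simp add: cinner_def sum_distrib_left algebra_simps)

lemma cinner_diff_right: "cinner x (y - z) = cinner x y - cinner x z"
  by (simp add: cinner_def algebra_simps sum_subtractf)

lemma cinner_minus_right: "cinner x (- y) = - cinner x y"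
  by (simp add: cinner_def sum_negf)

lemma cinner_sum_right: "cinner x (\<Sum>k\<in>K. f k) = (\<Sum>k\<in>K. cinner x (f k))"
  by (induction K rule: infinite_finite_induct)
     (simp_all add: cinner_add_right, simp_all add: cinner_def)

lemma cnj_cinner: "cnj (cinner x y) = cinner y x"
  by (simp add: cinner_def mult.commute)

lemma cinner_self: "cinner x x = complex_of_real ((norm x)\<^sup>2)"
proof -
  have "cinner x x = (\<Sum>i\<in>UNIV. complex_of_real ((cmod (x $ i))\<^sup>2))"
    unfolding cinner_def by (intro sum.cong refl) (metis complex_norm_square mult.commute)
  also have "\<dots> = complex_of_real ((norm x)\<^sup>2)"
    by (simp add: norm_vec_def L2_set_def sum_nonneg)
  finally show ?thesis .
qed

lemma cinner_matrix_right: "cinner x (M *v y) = cinner (cadjoint M *v x) y"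
  unfolding cinner_def matrix_vector_mult_def cadjoint_def
  by (simp add: sum_distrib_left sum_distrib_right)
     (subst sum.swap, simp add: mult_ac)

lemma cadjoint_cadjoint [simp]: "cadjoint (cadjoint M) = M"
  by (simp add: cadjoint_def vec_eq_iff)

lemma cadjoint_mult: "cadjoint (M ** N) = cadjoint N ** cadjoint M"
  by (simp add: cadjoint_def matrix_matrix_mult_def vec_eq_iff mult.commute)

lemma cadjoint_diff: "cadjoint (M - N) = cadjoint M - cadjoint N"
  by (simp add: cadjoint_def vec_eq_iff)

lemma cadjoint_sum: "cadjoint (\<Sum>k\<in>K. M k) = (\<Sum>k\<in>K. cadjoint (M k))"
  by (simp add: cadjoint_def vec_eq_iff)

lemma cadjoint_mat_1: "cadjoint (mat 1) = mat 1"
  by (auto simp: cadjoint_def vec_eq_iff mat_def)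

lemma matrix_mul_sum_right:
  fixes M :: "'a::semiring_1 ^ 'n ^ 'm"
  shows "M ** (\<Sum>k\<in>K. N k) = (\<Sum>k\<in>K. M ** N k)"
  by (simp add: matrix_matrix_mult_def vec_eq_iff sum_distrib_left) (intro allI sum.swap)

lemma matrix_mul_sum_left:
  fixes M :: "'k \<Rightarrow> 'a::semiring_1 ^ 'n ^ 'm"
  shows "(\<Sum>k\<in>K. M k) ** N = (\<Sum>k\<in>K. M k ** N)"
  by (simp add: matrix_matrix_mult_def vec_eq_iff sum_distrib_right) (intro allI sum.swap)

lemma matrix_diff_ldistrib:
  fixes A :: "'a::ring_1 ^ 'n ^ 'm"
  shows "A ** (B - D) = A ** B - A ** D"
  by (simp add: matrix_matrix_mult_def vec_eq_iff algebra_simps sum_subtractf)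

lemma matrix_diff_rdistrib:
  fixes A :: "'a::ring_1 ^ 'n ^ 'm"
  shows "(A - B) ** D = A ** D - B ** D"
  by (simp add: matrix_matrix_mult_def vec_eq_iff algebra_simps sum_subtractf)

lemma sum_matrix_vector_mult:
  fixes M :: "'k \<Rightarrow> 'a::semiring_1 ^ 'n ^ 'm"
  shows "(\<Sum>k\<in>K. M k) *v x = (\<Sum>k\<in>K. M k *v x)"
  by (simp add: matrix_vector_mult_def vec_eq_iff sum_distrib_right) (intro allI sum.swap)

section \<open>Fidelity of a composition of operator sums\<close>

lemma ketbra_sandwich: "M ** ketbra u v ** cadjoint N = ketbra (M *v u) (N *v v)"
  by (simp add: ketbra_def cadjoint_def matrix_matrix_mult_def matrix_vector_mult_def vec_eq_iff
      sum_distrib_left sum_distrib_right mult_ac)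

lemma Re_cinner_ketbra: "Re (cinner x (ketbra u u *v x)) = (cmod (cinner x u))\<^sup>2"
proof -
  have "ketbra u u *v x = cinner u x *s u"
    by (simp add: ketbra_def cinner_def matrix_vector_mult_def vec_eq_iff sum_distrib_left mult_ac)
  then have "cinner x (ketbra u u *v x) = cinner x u * cnj (cinner x u)"
    by (simp add: cinner_scale_right cnj_cinner)
  then show ?thesis by (simp add: complex_mult_cnj cmod_power2)
qed

text \<open>Each product of Kraus operators sends a pure state to another ket-bra, whose expectation
  is a squared modulus. All terms are nonnegative, so a lower bound may discard any of them.\<close>

lemma fidelity_operator_sum_comp:
  "fidelity (operator_sum L B \<circ> operator_sum K A) x =
     (\<Sum>l\<in>L. \<Sum>k\<in>K. (cmod (cinner x (B l *v (A k *v x))))\<^sup>2)"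
proof -
  have "(operator_sum L B \<circ> operator_sum K A) (ketbra x x) =
      (\<Sum>l\<in>L. \<Sum>k\<in>K. ketbra (B l *v (A k *v x)) (B l *v (A k *v x)))"
    by (simp add: operator_sum_def ketbra_sandwich matrix_mul_sum_right matrix_mul_sum_left)
  then show ?thesis
    by (simp add: fidelity_def sum_matrix_vector_mult cinner_sum_right Re_cinner_ketbra)
qed

lemma continuous_on_fidelity_operator_sum_comp:
  "continuous_on X (fidelity (operator_sum L B \<circ> operator_sum K A))"
proof -
  have "continuous_on X (\<lambda>x. \<Sum>l\<in>L. \<Sum>k\<in>K. (cmod (cinner x (B l *v (A k *v x))))\<^sup>2)"
    unfolding cinner_def matrix_vector_mult_def by (simp, intro continuous_intros)
  then show ?thesis by (simp add: fidelity_operator_sum_comp[abs_def])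
qed

section \<open>The subspace and its unit sphere\<close>

text \<open>An idempotent fixes exactly its range. Membership thereby becomes an equation, which
  serves both for closedness and for matrix calculations.\<close>

lemma orthogonal_projector_range:
  assumes "orthogonal_projector C P"
  shows "C = {x. P *v x = x}"
  using assms unfolding orthogonal_projector_def
  by (auto simp: matrix_vector_mul_assoc) (metis rangeI)

lemma unit_vectors_eq: "unit_vectors C = {x\<in>C. norm x = 1}"
proof -
  have "cinner x x = 1 \<longleftrightarrow> norm x = 1" for x :: "complex ^ 'n"
  proof -
    have "cinner x x = 1 \<longleftrightarrow> (norm x)\<^sup>2 = 1"
      unfolding cinner_self by (metis of_real_eq_1_iff)
    also have "\<dots> \<longleftrightarrow> norm x = 1" by (simp add: power2_eq_1_iff) (smt (verit) norm_ge_zero)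
    finally show ?thesis .
  qed
  then show ?thesis by (auto simp: unit_vectors_def)
qed

lemma compact_unit_vectors:
  assumes "orthogonal_projector C P"
  shows "compact (unit_vectors C)"
proof -
  have "closed {x. P *v x = x}"
    unfolding matrix_vector_mult_def by (intro closed_Collect_eq continuous_intros)
  then have "compact (sphere 0 1 \<inter> {x. P *v x = x})"
    by (intro compact_Int_closed) auto
  moreover have "unit_vectors C = sphere 0 1 \<inter> {x. P *v x = x}"
    by (auto simp: unit_vectors_eq orthogonal_projector_range[OF assms])
  ultimately show ?thesis by simp
qed

lemma norm_scale: "norm (c *s (x :: complex ^ 'n)) = cmod c * norm x"
  by (simp add: norm_vec_def L2_set_def norm_mult power_mult_distrib real_sqrt_mult
      flip: sum_distrib_left)

lemma normalized_mem_unit_vectors: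
  assumes "vec.subspace C" "x \<in> C" "x \<noteq> 0"
  shows "complex_of_real (inverse (norm x)) *s x \<in> unit_vectors C"
  using assms by (simp add: unit_vectors_eq norm_scale vec.subspace_scale norm_inverse)

lemma unit_vectors_nonempty:
  assumes "vec.subspace C" "C \<noteq> {0}"
  shows "unit_vectors C \<noteq> {}"
proof -
  obtain x where "x \<in> C" "x \<noteq> 0" using assms vec.subspace_0 by blast
  then show ?thesis using normalized_mem_unit_vectors[OF assms(1)] by blast
qed

section \<open>Rayleigh quotients and extremal eigenvalues\<close>

lemma vanishing_linear_term:
  fixes a b :: real
  assumes "\<And>s. 0 \<le> 2 * s * a + s\<^sup>2 * b" and "0 \<le> b"
  shows "a = 0"
proof (rule ccontr)
  assume "a \<noteq> 0"
  \<comment> \<open>The minimizer of the quadratic would be \<open>- a / b\<close>; the shift by one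
    keeps the denominator positive when \<open>b\<close> is zero, and the value is still
    negative.\<close>
  define c where "c = b + 1"
  have c: "c > 0" "b = c - 1" using assms(2) by (auto simp: c_def)
  have "2 * (- a / c) * a + (- a / c)\<^sup>2 * b = - (a\<^sup>2 * (c + 1)) / c\<^sup>2"
    unfolding c(2) using c(1) by (simp add: field_simps power2_eq_square)
  also have "\<dots> < 0" using \<open>a \<noteq> 0\<close> c(1) by (simp add: divide_neg_pos)
  finally show False using assms(1)[of "- a / c"] by linarith
qed

text \<open>A minimizer \<open>v\<close> of the Rayleigh quotient is an eigenvector: the form of \<open>H - r\<close> is nonnegative
  on \<open>C\<close> and vanishes at \<open>v\<close>, so its derivative at \<open>v\<close> in the direction \<open>(H - r) v\<close> is zero.\<close>
lemma hermitian_min_eigenvector: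
  assumes C: "vec.subspace C" "C \<noteq> {0}" "orthogonal_projector C P"
    and H: "cadjoint H = H" "\<And>x. x \<in> C \<Longrightarrow> H *v x \<in> C"
  obtains r where "r \<in> eigenvalues_on C H"
    "\<And>x. x \<in> unit_vectors C \<Longrightarrow> r \<le> Re (cinner x (H *v x))"
proof -
  let ?q = "\<lambda>x. Re (cinner x (H *v x))"
  have "continuous_on (unit_vectors C) ?q"
    unfolding cinner_def matrix_vector_mult_def by (simp, intro continuous_intros)
  then obtain v where v: "v \<in> unit_vectors C" and vmin: "\<And>x. x \<in> unit_vectors C \<Longrightarrow> ?q v \<le> ?q x"
    using continuous_attains_inf[OF compact_unit_vectors[OF C(3)] unit_vectors_nonempty[OF C(1,2)]]
    by blast
  define r where "r = ?q v"
  define G where "G x = H *v x - complex_of_real r *s x" for x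
  have vC: "v \<in> C" and nv: "norm v = 1" using v by (auto simp: unit_vectors_eq)
  have GC: "G x \<in> C" if "x \<in> C" for x
    unfolding G_def using that C(1) H(2) by (simp add: vec.subspace_diff vec.subspace_scale)
  have Gq: "Re (cinner x (G x)) = ?q x - r * (norm x)\<^sup>2" for x
    by (simp add: G_def cinner_diff_right cinner_scale_right cinner_self flip: of_real_power)
  \<comment> \<open>By homogeneity, minimality on the unit sphere extends to all of
    \<open>C\<close>.\<close>
  have Gpos: "0 \<le> Re (cinner x (G x))" if x: "x \<in> C" for x
  proof (cases "x = 0")
    case False
    let ?c = "inverse (norm x)"
    have "r \<le> ?q (complex_of_real ?c *s x)"
      unfolding r_def using vmin normalized_mem_unit_vectors[OF C(1) x False] by blast
    also have "\<dots> = ?c\<^sup>2 * ?q x"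
      by (simp add: vector_scalar_commute cinner_scale_left
          cinner_scale_right power2_eq_square flip: of_real_inverse)
    finally have "r * (norm x)\<^sup>2 \<le> ?q x"
      using False by (simp add: field_simps)
    then show ?thesis using Gq by simp
  qed (simp add: cinner_def)
  define w where "w = G v"
  have wC: "w \<in> C" using GC vC by (simp add: w_def)
  have Gsym: "cinner x (G y) = cinner (G x) y" for x y
  proof -
    have "cinner (G x) y = cnj (cinner y (G x))" by (simp add: cnj_cinner)
    also have "\<dots> = cinner (H *v x) y - complex_of_real r * cinner x y"
      by (simp add: G_def cinner_diff_right cinner_scale_right cnj_cinner)
    also have "\<dots> = cinner x (G y)"
      using H(1) by (simp add: G_def cinner_diff_right cinner_scale_right cinner_matrix_right)
    finally show ?thesis by simp
  qed
  have Gadd: "G (x + y) = G x + G y" for x y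
    by (simp add: G_def matrix_vector_right_distrib vec.scale_right_distrib)
  have Gscale: "G (c *s x) = c *s G x" for c x
    by (simp add: G_def vector_scalar_commute vec.scale_right_diff_distrib mult.commute)
  \<comment> \<open>The form of \<open>G\<close> at \<open>v + s w\<close> is expanded: the constant
    term vanishes by the choice of \<open>r\<close>, and since \<open>G\<close> is symmetric both
    cross terms equal \<open>s\<close> times the squared norm of \<open>w\<close>.\<close>
  have "0 \<le> 2 * s * (norm w)\<^sup>2 + s\<^sup>2 * Re (cinner w (G w))" for s :: real
  proof -
    let ?s = "complex_of_real s"
    have Glin: "G (v + ?s *s w) = w + ?s *s G w"
      unfolding w_def by (simp add: Gadd Gscale)
    have "Re (cinner (v + ?s *s w) (G (v + ?s *s w))) =
        Re (cinner v w) + s * Re (cinner w w) + s * Re (cinner v (G w)) + s\<^sup>2 * Re (cinner w (G w))"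
      unfolding Glin
      by (simp add: cinner_add_left cinner_add_right cinner_scale_left cinner_scale_right
          power2_eq_square algebra_simps)
    moreover have "Re (cinner v w) = 0" using Gq[of v] nv by (simp add: w_def r_def)
    moreover have "cinner v (G w) = cinner w w" by (simp add: Gsym w_def)
    moreover have "0 \<le> Re (cinner (v + ?s *s w) (G (v + ?s *s w)))"
      using Gpos C(1) vC wC by (simp add: vec.subspace_add vec.subspace_scale)
    ultimately show ?thesis by (simp add: cinner_self)
  qed
  then have "(norm w)\<^sup>2 = 0" using vanishing_linear_term Gpos[OF wC] by blast
  then have "H *v v = complex_of_real r *s v" by (simp add: w_def G_def)
  moreover have "v \<noteq> 0" using nv by auto
  ultimately have "r \<in> eigenvalues_on C H" using vC by (auto simp: eigenvalues_on_def)
  then show ?thesis using that vmin unfolding r_def by blast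
qed

text \<open>Negation turns maxima into minima: the eigenvalue \<open>r\<close> of \<open>- H\<close>
  that bounds its Rayleigh quotient from below gives the eigenvalue \<open>- r\<close> of
  \<open>H\<close>, which bounds that of \<open>H\<close> from above.\<close>

lemma rayleigh_le_largest_eigenvalue:
  assumes C: "vec.subspace C" "C \<noteq> {0}" "orthogonal_projector C P"
    and H: "cadjoint H = H" "\<And>x. x \<in> C \<Longrightarrow> H *v x \<in> C"
    and p: "is_largest_eigenvalue_on C H p" and x: "x \<in> unit_vectors C"
  shows "Re (cinner x (H *v x)) \<le> p"
proof -
  have neg: "(- H) *v y = - (H *v y)" for y
    by (simp add: matrix_vector_mult_def vec_eq_iff sum_negf)
  have "cadjoint (- H) = - H"
    using H(1) by (simp add: cadjoint_def vec_eq_iff)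
  moreover have "(- H) *v y \<in> C" if "y \<in> C" for y
    using H(2)[OF that] C(1) by (simp add: neg vec.subspace_neg)
  ultimately obtain r where r: "r \<in> eigenvalues_on C (- H)"
    and le: "\<And>y. y \<in> unit_vectors C \<Longrightarrow> r \<le> Re (cinner y ((- H) *v y))"
    using hermitian_min_eigenvector[OF C, of "- H"] by blast
  have "- r \<in> eigenvalues_on C H"
    using r by (auto simp: eigenvalues_on_def neg) (metis minus_minus)
  then have "- r \<le> p" using p by (simp add: is_largest_eigenvalue_on_def)
  moreover have "Re (cinner x (H *v x)) \<le> - r"
    using le[OF x] by (simp add: neg cinner_minus_right)
  ultimately show ?thesis by linarith
qed

text \<open>By Cauchy-Schwarz the square of the expectation of \<open>S\<close> is at most that of
  \<open>X\<close>, so a lower bound on the Rayleigh quotient of \<open>X\<close> would not suffice.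
  The argument goes through the spectrum of \<open>S\<close> instead: its smallest Rayleigh value
  \<open>r\<close> is an eigenvalue, and the square of \<open>r\<close> is one of
  \<open>X\<close>.\<close>

lemma smallest_eigenvalue_le_pos_sqrt:
  assumes C: "vec.subspace C" "C \<noteq> {0}" "orthogonal_projector C P"
    and S: "is_pos_sqrt S X" and XP: "X ** P = X"
    and m: "is_smallest_eigenvalue_on C X m" and x: "x \<in> unit_vectors C"
  shows "m \<le> (Re (cinner x (S *v x)))\<^sup>2"
proof -
  have Sh: "cadjoint S = S" and Spos: "\<And>y. 0 \<le> Re (cinner y (S *v y))" and SS: "S ** S = X"
    using S by (auto simp: is_pos_sqrt_def positive_op_def)
  have CP: "C = {y. P *v y = y}" and Ph: "cadjoint P = P"
    using C(3) orthogonal_projector_range by (auto simp: orthogonal_projector_def)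
  \<comment> \<open>\<open>S\<close> vanishes on the orthogonal complement of \<open>C\<close>
    because \<open>X\<close> does: for Hermitian \<open>S\<close> the squared norm of
    \<open>S z\<close> is the expectation of \<open>X\<close> at \<open>z\<close>. Taking adjoints
    of \<open>S ** P = S\<close> then shows that \<open>S\<close> maps into
    \<open>C\<close>.\<close>
  have "S *v (y - P *v y) = 0" for y
  proof -
    have "S *v (S *v (y - P *v y)) = X *v y - (X ** P) *v y"
      by (simp add: matrix_vector_mult_diff_distrib matrix_vector_mul_assoc matrix_mul_assoc SS)
    then have "S *v (S *v (y - P *v y)) = 0" by (simp add: XP)
    then have "cinner (S *v (y - P *v y)) (S *v (y - P *v y)) = 0"
      using Sh by (metis cinner_matrix_right cinner_scale_right mult_zero_left vector_smult_lzero)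
    then show ?thesis by (simp add: cinner_self)
  qed
  then have SPv: "S *v (P *v y) = S *v y" for y
    by (simp add: matrix_vector_mult_diff_distrib)
  then have "S ** P = S" by (simp add: matrix_eq flip: matrix_vector_mul_assoc)
  then have "P ** S = S" using Sh Ph by (metis cadjoint_mult)
  then have SC: "S *v y \<in> C" for y by (simp add: CP matrix_vector_mul_assoc)
  obtain r where r: "r \<in> eigenvalues_on C S"
    and le: "\<And>y. y \<in> unit_vectors C \<Longrightarrow> r \<le> Re (cinner y (S *v y))"
    using hermitian_min_eigenvector[OF C Sh SC] by blast
  obtain v where v: "v \<in> C" "v \<noteq> 0" "S *v v = complex_of_real r *s v"
    using r by (auto simp: eigenvalues_on_def)
  have "0 \<le> r * (norm v)\<^sup>2"
    using Spos[of v] v(3) by (simp add: cinner_scale_right cinner_self flip: of_real_power)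
  \<comment> \<open>Positivity of \<open>S\<close> rules out a negative \<open>r\<close>, so that
    squaring preserves the lower bound.\<close>
  then have r0: "0 \<le> r" using v(2) by (simp add: zero_le_mult_iff)
  have "X *v v = complex_of_real (r\<^sup>2) *s v"
    using v(3) by (simp add: vector_scalar_commute power2_eq_square
        flip: SS matrix_vector_mul_assoc)
  then have "r\<^sup>2 \<in> eigenvalues_on C X" using v by (auto simp: eigenvalues_on_def)
  then have "m \<le> r\<^sup>2" using m by (simp add: is_smallest_eigenvalue_on_def)
  also have "\<dots> \<le> (Re (cinner x (S *v x)))\<^sup>2" using r0 le[OF x] by (rule power_mono[rotated])
  finally show ?thesis .
qed

section \<open>Construction of the recovery operation and its fidelity\<close>

text \<open>The Kraus operators are indexed by naturals to fit \<open>tp_quantum_operation\<close>;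
  the injection \<open>j\<close> records where the operator belonging to each \<open>n\<close> is
  found.\<close>

lemma recovery_exists:
  fixes P :: "complex ^ 'n ^ 'n" and U :: "'k \<Rightarrow> complex ^ 'n ^ 'n"
  assumes P: "P ** P = P" "cadjoint P = P" and J: "finite J"
    and orth: "\<And>m n. m \<in> J \<Longrightarrow> n \<in> J \<Longrightarrow>
      P ** cadjoint (U m) ** U n ** P = (if m = n then P else 0)"
  obtains L :: "nat set" and B j where "finite L" "trace_preserving L B"
    "inj_on j J" "j ` J \<subseteq> L" "\<And>n. n \<in> J \<Longrightarrow> B (j n) = P ** cadjoint (U n)"
proof -
  obtain j where j: "bij_betw j J {0..<card J}" using ex_bij_betw_finite_nat[OF J] by blast
  define Q where "Q = (\<Sum>n\<in>J. U n ** P ** cadjoint (U n))"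
  \<comment> \<open>The indices below \<open>card J\<close> carry the corrections, and the index
    \<open>card J\<close> itself carries the complement of \<open>Q\<close>; hence the index set
    \<open>{..card J}\<close> with one extra element.\<close>
  define B where "B i = (if i < card J then P ** cadjoint (U (the_inv_into J j i)) else mat 1 - Q)" for i
  have inj: "inj_on j J" using j by (simp add: bij_betw_def)
  have jlt: "j n < card J" if "n \<in> J" for n using j that by (auto simp: bij_betw_def)
  have Bj: "B (j n) = P ** cadjoint (U n)" if "n \<in> J" for n
    using that inj by (simp add: B_def jlt the_inv_into_f_f)
  have Qh: "cadjoint Q = Q"
    by (simp add: Q_def cadjoint_sum cadjoint_mult P(2) matrix_mul_assoc)
  \<comment> \<open>After reassociation the orthogonality condition stands in the middle, so the
    summands of \<open>Q\<close> are mutually orthogonal projectors.\<close>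
  have prod: "(U m ** P ** cadjoint (U m)) ** (U n ** P ** cadjoint (U n)) =
      (if m = n then U m ** P ** cadjoint (U m) else 0)" if "m \<in> J" "n \<in> J" for m n
  proof -
    have "(U m ** P ** cadjoint (U m)) ** (U n ** P ** cadjoint (U n)) =
        U m ** (P ** cadjoint (U m) ** U n ** P) ** cadjoint (U n)"
      by (simp add: matrix_mul_assoc)
    then show ?thesis
      using orth[OF that] by (auto simp: matrix_matrix_mult_def vec_eq_iff)
  qed
  have "Q ** Q = (\<Sum>n\<in>J. \<Sum>m\<in>J. if m = n then U m ** P ** cadjoint (U m) else 0)"
    unfolding Q_def matrix_mul_sum_right matrix_mul_sum_left
    by (intro sum.cong refl prod)
  also have "\<dots> = Q" using J by (simp add: Q_def)
  finally have QQ: "Q ** Q = Q" .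
  have "trace_preserving {..card J} B"
  proof -
    have "(\<Sum>i\<in>{..card J}. cadjoint (B i) ** B i) =
        (\<Sum>i\<in>{0..<card J}. cadjoint (B i) ** B i) + cadjoint (mat 1 - Q) ** (mat 1 - Q)"
      by (simp add: B_def atLeast0LessThan flip: lessThan_Suc_atMost)
    also have "cadjoint (mat 1 - Q) ** (mat 1 - Q) = mat 1 - Q"
      by (simp add: cadjoint_diff cadjoint_mat_1 Qh matrix_diff_ldistrib matrix_diff_rdistrib QQ)
    also have "(\<Sum>i\<in>{0..<card J}. cadjoint (B i) ** B i) = (\<Sum>n\<in>J. cadjoint (B (j n)) ** B (j n))"
      by (rule sum.reindex_bij_betw[OF j, symmetric])
    also have "\<dots> = Q"
      unfolding Q_def
    proof (rule sum.cong)
      fix n assume "n \<in> J"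
      then have "cadjoint (B (j n)) ** B (j n) = U n ** (P ** P) ** cadjoint (U n)"
        by (simp only: Bj cadjoint_mult cadjoint_cadjoint P(2) matrix_mul_assoc)
      then show "cadjoint (B (j n)) ** B (j n) = U n ** P ** cadjoint (U n)" by (simp add: P(1))
    qed simp
    finally show ?thesis by (simp add: trace_preserving_def)
  qed
  moreover have "j ` J \<subseteq> {..card J}" using jlt by (auto intro: less_imp_le)
  ultimately show ?thesis using that[of "{..card J}" B j] inj Bj by blast
qed

text \<open>This is the bound for one fixed value of the small parameter, with
  \<open>\<mu> n\<close> in the role of the product of \<open>p\<close> and
  \<open>lam\<close>.\<close>

lemma recovery_min_fidelity:
  fixes C :: "(complex ^ 'n) set" and A U :: "'k \<Rightarrow> complex ^ 'n ^ 'n"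
  assumes C: "vec.subspace C" "C \<noteq> {0}" "orthogonal_projector C P"
    and K: "finite K" "J \<subseteq> K"
    and U: "\<And>n. n \<in> J \<Longrightarrow> unitary (U n)"
    and polar: "\<And>n. n \<in> J \<Longrightarrow>
      \<exists>S. is_pos_sqrt S (P ** cadjoint (A n) ** A n ** P) \<and> A n ** P = U n ** S"
    and small: "\<And>n. n \<in> J \<Longrightarrow>
      is_smallest_eigenvalue_on C (P ** cadjoint (A n) ** A n ** P) (\<mu> n)"
    and orth: "\<And>m n. m \<in> J \<Longrightarrow> n \<in> J \<Longrightarrow>
      P ** cadjoint (U m) ** U n ** P = (if m = n then P else 0)"
  obtains R F where "tp_quantum_operation R" "is_min_fidelity C (R \<circ> operator_sum K A) F"
    "(\<Sum>n\<in>J. \<mu> n) \<le> F"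
proof -
  have PP: "P ** P = P" and Ph: "cadjoint P = P"
    using C(3) by (auto simp: orthogonal_projector_def)
  have CP: "C = {y. P *v y = y}" using C(3) by (rule orthogonal_projector_range)
  have J: "finite J" using K finite_subset by blast
  obtain L :: "nat set" and B j where L: "finite L" "trace_preserving L B"
    "inj_on j J" "j ` J \<subseteq> L" "\<And>n. n \<in> J \<Longrightarrow> B (j n) = P ** cadjoint (U n)"
    using recovery_exists[OF PP Ph J orth] by metis
  let ?f = "fidelity (operator_sum L B \<circ> operator_sum K A)"
  have bound: "(\<Sum>n\<in>J. \<mu> n) \<le> ?f x" if x: "x \<in> unit_vectors C" for x
  proof -
    have xP: "P *v x = x" using x by (simp add: CP unit_vectors_def)
    have "\<mu> n \<le> (cmod (cinner x (B (j n) *v (A n *v x))))\<^sup>2" if n: "n \<in> J" for n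
    proof -
      obtain S where S: "is_pos_sqrt S (P ** cadjoint (A n) ** A n ** P)" "A n ** P = U n ** S"
        using polar[OF n] by blast
      \<comment> \<open>As \<open>P\<close> fixes \<open>x\<close>, the polar decomposition applies
        to \<open>A n *v x\<close>. The correction cancels the unitary, and its remaining
        \<open>P\<close> is absorbed by \<open>x\<close> inside the inner product.\<close>
      have "A n *v x = U n *v (S *v x)"
        using S(2) xP by (metis matrix_vector_mul_assoc)
      then have "cadjoint (U n) *v (A n *v x) = S *v x"
        using U[OF n] by (simp add: unitary_def matrix_vector_mul_assoc matrix_mul_assoc)
      then have "B (j n) *v (A n *v x) = P *v (S *v x)"
        by (simp add: L(5)[OF n] flip: matrix_vector_mul_assoc)
      then have eq: "cinner x (B (j n) *v (A n *v x)) = cinner x (S *v x)"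
        by (simp add: cinner_matrix_right[of x P] Ph xP)
      have "\<mu> n \<le> (Re (cinner x (S *v x)))\<^sup>2"
        by (rule smallest_eigenvalue_le_pos_sqrt[OF C S(1) _ small[OF n] x])
           (metis PP matrix_mul_assoc)
      also have "\<dots> \<le> (cmod (cinner x (S *v x)))\<^sup>2"
        by (simp add: cmod_power2)
      finally show ?thesis by (simp add: eq)
    qed
    then have "(\<Sum>n\<in>J. \<mu> n) \<le> (\<Sum>n\<in>J. (cmod (cinner x (B (j n) *v (A n *v x))))\<^sup>2)"
      by (rule sum_mono)
    \<comment> \<open>Only the matched pairs \<open>(j n, n)\<close> have been estimated.
      Nonnegative terms now complete them to the full double sum, first over all errors
      \<open>k\<close>, then over all Kraus operators of the recovery.\<close>
    also have "\<dots> \<le> (\<Sum>n\<in>J. \<Sum>k\<in>K. (cmod (cinner x (B (j n) *v (A k *v x))))\<^sup>2)"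
      using K by (intro sum_mono member_le_sum) auto
    also have "\<dots> = (\<Sum>l\<in>j ` J. \<Sum>k\<in>K. (cmod (cinner x (B l *v (A k *v x))))\<^sup>2)"
      by (simp add: sum.reindex[OF L(3)])
    also have "\<dots> \<le> (\<Sum>l\<in>L. \<Sum>k\<in>K. (cmod (cinner x (B l *v (A k *v x))))\<^sup>2)"
      by (intro sum_mono2 L sum_nonneg) simp
    finally show ?thesis by (simp add: fidelity_operator_sum_comp)
  qed
  obtain y where y: "y \<in> unit_vectors C" "\<And>x. x \<in> unit_vectors C \<Longrightarrow> ?f y \<le> ?f x"
    using continuous_attains_inf[OF compact_unit_vectors[OF C(3)] unit_vectors_nonempty[OF C(1,2)]
        continuous_on_fidelity_operator_sum_comp]
    by metis
  show ?thesis
  proof (rule that)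
    show "tp_quantum_operation (operator_sum L B)"
      using L by (auto simp: tp_quantum_operation_def)
    show "is_min_fidelity C (operator_sum L B \<circ> operator_sum K A) (?f y)"
      using y by (auto simp: is_min_fidelity_def)
    show "(\<Sum>n\<in>J. \<mu> n) \<le> ?f y" using bound y by blast
  qed
qed

section \<open>The asymptotic bound\<close>

text \<open>On vectors of \<open>C\<close> the compression by \<open>P\<close> does not change the
  expectation, so the Rayleigh bound for the compressed operator applies.\<close>

lemma expectation_le_largest_eigenvalue:
  assumes C: "vec.subspace C" "C \<noteq> {0}" "orthogonal_projector C P"
    and p: "is_largest_eigenvalue_on C (P ** cadjoint M ** M ** P) p"
    and x: "x \<in> unit_vectors C"
  shows "Re (cinner x ((cadjoint M ** M) *v x)) \<le> p"
proof -
  let ?X = "P ** cadjoint M ** M ** P"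
  have PP: "P ** P = P" and Ph: "cadjoint P = P"
    using C(3) by (auto simp: orthogonal_projector_def)
  have CP: "C = {y. P *v y = y}" using C(3) by (rule orthogonal_projector_range)
  have xP: "P *v x = x" using x by (simp add: CP unit_vectors_def)
  have "cadjoint ?X = ?X" by (simp add: cadjoint_mult Ph matrix_mul_assoc)
  moreover have "?X *v y \<in> C" for y by (simp add: CP matrix_vector_mul_assoc matrix_mul_assoc PP)
  ultimately have "Re (cinner x (?X *v x)) \<le> p"
    using rayleigh_le_largest_eigenvalue[OF C _ _ p x] by blast
  moreover have "?X *v x = P *v ((cadjoint M ** M) *v x)"
    by (metis xP matrix_vector_mul_assoc)
  ultimately show ?thesis by (simp add: cinner_matrix_right[of x P] Ph xP)
qed

text \<open>An inequality up to big-O becomes an eventual inequality with some \<open>g\<close> of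
  that order as \<epsilon> tends to zero from the right. The error bound on the total probability
  may depend on \<psi>, and the asymptotic conclusion concerns the same \<open>F\<close> as the
  first one.\<close>

theorem mainTheorem1:
  fixes C :: "(complex ^ 'n) set"
    and P :: "complex ^ 'n ^ 'n"
    and K Kre :: "'k set"
    and A U :: "real \<Rightarrow> 'k \<Rightarrow> complex ^ 'n ^ 'n"
    and p lam :: "real \<Rightarrow> 'k \<Rightarrow> real"
    and \<epsilon>0 :: real and t :: nat
  assumes "vec.subspace C" and "C \<noteq> {0}"
    and "orthogonal_projector C P"
    and "finite K" and "Kre \<subseteq> K"
    and "\<epsilon>0 > 0"
    and "\<And>\<epsilon>. \<epsilon> \<in> {0<..<\<epsilon>0} \<Longrightarrow> trace_preserving K (A \<epsilon>)"
    and "\<And>\<epsilon> n. \<epsilon> \<in> {0<..<\<epsilon>0} \<Longrightarrow> n \<in> Kre \<Longrightarrow> unitary (U \<epsilon> n)"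
    and "\<And>\<epsilon> n. \<epsilon> \<in> {0<..<\<epsilon>0} \<Longrightarrow> n \<in> Kre \<Longrightarrow>
           \<exists>S. is_pos_sqrt S (P ** cadjoint (A \<epsilon> n) ** A \<epsilon> n ** P) \<and> A \<epsilon> n ** P = U \<epsilon> n ** S"
    and "\<And>\<epsilon> n. \<epsilon> \<in> {0<..<\<epsilon>0} \<Longrightarrow> n \<in> Kre \<Longrightarrow>
           is_largest_eigenvalue_on C (P ** cadjoint (A \<epsilon> n) ** A \<epsilon> n ** P) (p \<epsilon> n)"
    and "\<And>\<epsilon> n. \<epsilon> \<in> {0<..<\<epsilon>0} \<Longrightarrow> n \<in> Kre \<Longrightarrow>
           is_smallest_eigenvalue_on C (P ** cadjoint (A \<epsilon> n) ** A \<epsilon> n ** P) (p \<epsilon> n * lam \<epsilon> n)"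
    and "\<And>\<epsilon> n. \<epsilon> \<in> {0<..<\<epsilon>0} \<Longrightarrow> n \<in> Kre \<Longrightarrow> p \<epsilon> n = 0 \<Longrightarrow> lam \<epsilon> n = 1"
    and "\<And>\<epsilon> m n. \<epsilon> \<in> {0<..<\<epsilon>0} \<Longrightarrow> m \<in> Kre \<Longrightarrow> n \<in> Kre \<Longrightarrow>
           P ** cadjoint (U \<epsilon> m) ** U \<epsilon> n ** P = (if m = n then P else 0)"
  shows "\<exists>(R :: real \<Rightarrow> complex ^ 'n ^ 'n \<Rightarrow> complex ^ 'n ^ 'n) (F :: real \<Rightarrow> real).
           (\<forall>\<epsilon>\<in>{0<..<\<epsilon>0}.
              tp_quantum_operation (R \<epsilon>) \<and>
              is_min_fidelity C (R \<epsilon> \<circ> operator_sum K (A \<epsilon>)) (F \<epsilon>) \<and>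
              F \<epsilon> \<ge> (\<Sum>n\<in>Kre. p \<epsilon> n * lam \<epsilon> n)) \<and>
           ((\<forall>n\<in>Kre. \<exists>g\<in>O[at_right 0](\<lambda>\<epsilon>. \<epsilon> ^ (t + 1)).
               \<forall>\<^sub>F \<epsilon> in at_right 0. p \<epsilon> n * (1 - lam \<epsilon> n) \<le> g \<epsilon>) \<and>
            (\<forall>\<psi>\<in>unit_vectors C. \<exists>g\<in>O[at_right 0](\<lambda>\<epsilon>. \<epsilon> ^ (t + 1)).
               \<forall>\<^sub>F \<epsilon> in at_right 0.
                 (\<Sum>n\<in>Kre. Re (cinner \<psi> ((cadjoint (A \<epsilon> n) ** A \<epsilon> n) *v \<psi>))) \<ge> 1 - g \<epsilon>) \<longrightarrow>
            (\<exists>g\<in>O[at_right 0](\<lambda>\<epsilon>. \<epsilon> ^ (t + 1)).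
               \<forall>\<^sub>F \<epsilon> in at_right 0. F \<epsilon> \<ge> 1 - g \<epsilon>))"
proof -
  let ?I = "{0<..<\<epsilon>0}"
  have "\<exists>R F. tp_quantum_operation R \<and> is_min_fidelity C (R \<circ> operator_sum K (A \<epsilon>)) F \<and>
      F \<ge> (\<Sum>n\<in>Kre. p \<epsilon> n * lam \<epsilon> n)" if \<epsilon>: "\<epsilon> \<in> ?I" for \<epsilon>
    using recovery_min_fidelity[OF assms(1-5) assms(8)[OF \<epsilon>] assms(9)[OF \<epsilon>] assms(11)[OF \<epsilon>]
        assms(13)[OF \<epsilon>]]
    by metis
  then obtain R F where RF: "\<forall>\<epsilon>\<in>?I. tp_quantum_operation (R \<epsilon>) \<and>
      is_min_fidelity C (R \<epsilon> \<circ> operator_sum K (A \<epsilon>)) (F \<epsilon>) \<and>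
      F \<epsilon> \<ge> (\<Sum>n\<in>Kre. p \<epsilon> n * lam \<epsilon> n)"
    by metis
  have "\<exists>g\<in>O[at_right 0](\<lambda>\<epsilon>. \<epsilon> ^ (t + 1)). \<forall>\<^sub>F \<epsilon> in at_right 0. F \<epsilon> \<ge> 1 - g \<epsilon>"
    if near: "\<forall>n\<in>Kre. \<exists>g\<in>O[at_right 0](\<lambda>\<epsilon>. \<epsilon> ^ (t + 1)).
          \<forall>\<^sub>F \<epsilon> in at_right 0. p \<epsilon> n * (1 - lam \<epsilon> n) \<le> g \<epsilon>"
      and total: "\<forall>\<psi>\<in>unit_vectors C. \<exists>g\<in>O[at_right 0](\<lambda>\<epsilon>. \<epsilon> ^ (t + 1)).
          \<forall>\<^sub>F \<epsilon> in at_right 0.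
            (\<Sum>n\<in>Kre. Re (cinner \<psi> ((cadjoint (A \<epsilon> n) ** A \<epsilon> n) *v \<psi>))) \<ge> 1 - g \<epsilon>"
  proof -
    have fin: "finite Kre" using assms(4,5) finite_subset by blast
    \<comment> \<open>One unit vector, independent of \<epsilon>, is enough: its expectations are
      dominated by the eigenvalues \<open>p\<close>, which do not refer to it.\<close>
    obtain \<psi> where \<psi>: "\<psi> \<in> unit_vectors C" using unit_vectors_nonempty[OF assms(1,2)] by blast
    obtain g where g: "\<And>n. n \<in> Kre \<Longrightarrow> g n \<in> O[at_right 0](\<lambda>\<epsilon>. \<epsilon> ^ (t + 1))"
      "\<And>n. n \<in> Kre \<Longrightarrow> \<forall>\<^sub>F \<epsilon> in at_right 0. p \<epsilon> n * (1 - lam \<epsilon> n) \<le> g n \<epsilon>"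
      using near by metis
    obtain h where h: "h \<in> O[at_right 0](\<lambda>\<epsilon>. \<epsilon> ^ (t + 1))"
      "\<forall>\<^sub>F \<epsilon> in at_right 0.
        (\<Sum>n\<in>Kre. Re (cinner \<psi> ((cadjoint (A \<epsilon> n) ** A \<epsilon> n) *v \<psi>))) \<ge> 1 - h \<epsilon>"
      using total \<psi> by blast
    have "(\<lambda>\<epsilon>. h \<epsilon> + (\<Sum>n\<in>Kre. g n \<epsilon>)) \<in> O[at_right 0](\<lambda>\<epsilon>. \<epsilon> ^ (t + 1))"
      using g(1) h(1) by (intro sum_in_bigo(1) big_sum_in_bigo)
    \<comment> \<open>Finiteness of \<open>Kre\<close> lets the separate eventual bounds hold
      simultaneously.\<close>
    moreover have "\<forall>\<^sub>F \<epsilon> in at_right 0. \<forall>n\<in>Kre. p \<epsilon> n * (1 - lam \<epsilon> n) \<le> g n \<epsilon>"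
      using fin g(2) by (simp add: eventually_ball_finite)
    moreover have "\<forall>\<^sub>F \<epsilon> in at_right 0. \<epsilon> \<in> ?I"
      using assms(6) by (rule eventually_at_right_real)
    ultimately show ?thesis
    proof (intro bexI)
      assume ev: "\<forall>\<^sub>F \<epsilon> in at_right 0. \<forall>n\<in>Kre. p \<epsilon> n * (1 - lam \<epsilon> n) \<le> g n \<epsilon>"
        "\<forall>\<^sub>F \<epsilon> in at_right 0. \<epsilon> \<in> ?I"
      from ev h(2) show "\<forall>\<^sub>F \<epsilon> in at_right 0. F \<epsilon> \<ge> 1 - (h \<epsilon> + (\<Sum>n\<in>Kre. g n \<epsilon>))"
      proof eventually_elim
        case (elim \<epsilon>)
        have "1 - h \<epsilon> \<le> (\<Sum>n\<in>Kre. p \<epsilon> n)"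
          using elim(3) sum_mono[of Kre, OF expectation_le_largest_eigenvalue[OF assms(1-3)
                assms(10)[OF elim(2)] \<psi>]]
          by (rule order_trans)
        also have "\<dots> = (\<Sum>n\<in>Kre. p \<epsilon> n * lam \<epsilon> n) + (\<Sum>n\<in>Kre. p \<epsilon> n * (1 - lam \<epsilon> n))"
          by (simp add: algebra_simps flip: sum.distrib)
        also have "\<dots> \<le> F \<epsilon> + (\<Sum>n\<in>Kre. g n \<epsilon>)"
          using RF elim by (intro add_mono sum_mono) auto
        finally show ?case by simp
      qed
    qed
  qed
  with RF show ?thesis by blast
qed

end
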